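(* Let $F$ be a field with a valuation $v$ and value group $\Gamma_v$, let $E/F$ be a finite field extension, and let $w$ be a quasi-valuation on $E$ extending $v$ such that $w(E\setminus\{0\})$ is torsion over $\Gamma_v$. Then there exists a valuation $u$ on $E$ extending $v$ such that $u$ dominates $w$, i.e. $w(x)\le u(x)$ for all $x\in E$. Moreover, every valuation $u$ on $E$ extending $v$ and satisfying $O_u\supseteq O_w$ dominates $w$.
   Context: A totally ordered abelian monoid is a commutative monoid $(M,+)$ with a total order such that $a\le b$ implies $a+c\le b+c$. One adjoins $\infty$, greater than all elements of $M$, with $m+\infty=\infty$. A quasi-valuation on a ring $A$ is a function $w:A\to M\cup\{\infty\}$, $M$ a totally ordered abelian monoid, with $w(0)=\infty$, $w(xy)\ge w(x)+w(y)$ and $w(x+y)\ge\min\{w(x),w(y)\}$ for all $x,y\in A$. $w$ extends $v$ means that $\Gamma_v$ is contained in $M$ as an ordered submonoid and $w|_F=v$. For $x\neq 0$ one has $w(x)\neq\infty$. "$w(E\setminus\{0\})$ is torsion over $\Gamma_v$" means: for every $0\ne x\in E$ there is an integer $k\ge1$ with $k\,w(x)\in\Gamma_v$. $O_w=\{x\in E\mid w(x)\ge0\}$, and $O_u$ is the valuation ring of $u$. Under the torsion hypothesis the submonoid $\Gamma_w$ of $M$ generated by $w(E\setminus\{0\})$ is a group torsion over $\Gamma_v$, and so is the value group $\Gamma_u$ of any valuation $u$ of $E$ extending $v$; both are embedded in the divisible hull $\Gamma_{\text{div}}$ of $\Gamma_v$ (order-preservingly and over $\Gamma_v$), and values of $w$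 and $u$ are compared in $\Gamma_{\text{div}}\cup\{\infty\}$. *)

theory Defs
  imports Complex_Main
begin

section \<open>Adjoining infinity\<close>

datatype 'a adj_infty = Fin 'a | Infty

instantiation adj_infty :: (linorder) linorder
begin

fun less_eq_adj_infty :: "'a adj_infty \<Rightarrow> 'a adj_infty \<Rightarrow> bool" where
  "less_eq_adj_infty (Fin a) (Fin b) \<longleftrightarrow> a \<le> b"
| "less_eq_adj_infty _ Infty \<longleftrightarrow> True"
| "less_eq_adj_infty Infty (Fin b) \<longleftrightarrow> False"

definition less_adj_infty :: "'a adj_infty \<Rightarrow> 'a adj_infty \<Rightarrow> bool" where
  "less_adj_infty x y \<longleftrightarrow> x \<le> y \<and> \<not> y \<le> x"

instance
proof
  fix x y z :: "'a adj_infty"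
  show "(x < y) = (x \<le> y \<and> \<not> y \<le> x)" by (simp add: less_adj_infty_def)
  show "x \<le> x" by (cases x) auto
  show "x \<le> y \<Longrightarrow> y \<le> z \<Longrightarrow> x \<le> z" by (cases x; cases y; cases z) auto
  show "x \<le> y \<Longrightarrow> y \<le> x \<Longrightarrow> x = y" by (cases x; cases y) auto
  show "x \<le> y \<or> y \<le> x" by (cases x; cases y) auto
qed

end

instantiation adj_infty :: (comm_monoid_add) comm_monoid_add
begin

definition zero_adj_infty :: "'a adj_infty" where
  "0 = Fin 0"

fun plus_adj_infty :: "'a adj_infty \<Rightarrow> 'a adj_infty \<Rightarrow> 'a adj_infty" where
  "plus_adj_infty (Fin a) (Fin b) = Fin (a + b)"
| "plus_adj_infty _ _ = Infty"

instance
proof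
  fix x y z :: "'a adj_infty"
  show "x + y + z = x + (y + z)" by (cases x; cases y; cases z) (auto simp: add.assoc)
  show "x + y = y + x" by (cases x; cases y) (auto simp: add.commute)
  show "0 + x = x" by (cases x) (auto simp: zero_adj_infty_def)
qed

end

section \<open>Valuations and quasi-valuations\<close>

text \<open>
  The sort \<open>{linorder, ordered_comm_monoid_add}\<close> is that of totally ordered abelian monoids.
\<close>

definition quasi_valuation ::
    "('a::ring_1 \<Rightarrow> 'm::{linorder,ordered_comm_monoid_add} adj_infty) \<Rightarrow> bool" where
  "quasi_valuation w \<longleftrightarrow>
     w 0 = Infty \<and>
     (\<forall>x y. w (x * y) \<ge> w x + w y) \<and>
     (\<forall>x y. w (x + y) \<ge> min (w x) (w y))"

definition valuation ::
    "('k::field \<Rightarrow> 'g::linordered_ab_group_add adj_infty) \<Rightarrow> bool" where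
  "valuation v \<longleftrightarrow>
     (\<forall>x. v x = Infty \<longleftrightarrow> x = 0) \<and>
     (\<forall>x y. v (x * y) = v x + v y) \<and>
     (\<forall>x y. v (x + y) \<ge> min (v x) (v y))"

text \<open>The group need not be exhausted by the valuation, so the value group is a subset of it.\<close>

definition value_group ::
    "('k::field \<Rightarrow> 'g::linordered_ab_group_add adj_infty) \<Rightarrow> 'g set" where
  "value_group v = {\<gamma>. \<exists>x. x \<noteq> 0 \<and> v x = Fin \<gamma>}"

definition val_ring :: "('a \<Rightarrow> 'm::{linorder,comm_monoid_add} adj_infty) \<Rightarrow> 'a set" where
  "val_ring w = {x. w x \<ge> 0}"

section \<open>Extensions\<close>

text \<open>A field extension is given by its inclusion map \<open>emb\<close>.\<close>

definition finite_extension :: "('f::field \<Rightarrow> 'e::field) \<Rightarrow> bool" where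
  "finite_extension emb \<longleftrightarrow>
     emb 1 = 1 \<and>
     (\<forall>a b. emb (a + b) = emb a + emb b) \<and>
     (\<forall>a b. emb (a * b) = emb a * emb b) \<and>
     (\<exists>B. finite_dimensional_vector_space (\<lambda>a x. emb a * x) B)"

text \<open>
  The inclusion of \<open>\<Gamma>\<close> in \<open>M\<close> as an ordered submonoid. Only the values of \<open>\<iota>\<close>
  on \<open>\<Gamma>\<close> matter.
\<close>

definition ordered_embedding ::
    "'g::linordered_ab_group_add set \<Rightarrow> ('g \<Rightarrow> 'm::{linorder,ordered_comm_monoid_add}) \<Rightarrow> bool" where
  "ordered_embedding \<Gamma> \<iota> \<longleftrightarrow>
     \<iota> 0 = 0 \<and>
     (\<forall>a\<in>\<Gamma>. \<forall>b\<in>\<Gamma>. \<iota> (a + b) = \<iota> a + \<iota> b) \<and>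
     strict_mono_on \<Gamma> \<iota>"

definition extends ::
    "('f::field \<Rightarrow> 'e::field) \<Rightarrow> ('f \<Rightarrow> 'g::linordered_ab_group_add adj_infty)
      \<Rightarrow> ('g \<Rightarrow> 'm::{linorder,ordered_comm_monoid_add}) \<Rightarrow> ('e \<Rightarrow> 'm adj_infty) \<Rightarrow> bool" where
  "extends emb v \<iota> w \<longleftrightarrow>
     ordered_embedding (value_group v) \<iota> \<and>
     (\<forall>a. w (emb a) = map_adj_infty \<iota> (v a))"

definition nmult :: "nat \<Rightarrow> 'a::comm_monoid_add \<Rightarrow> 'a" where
  "nmult k m = (\<Sum>i<k. m)"

definition torsion_over ::
    "'g set \<Rightarrow> ('g \<Rightarrow> 'm::comm_monoid_add) \<Rightarrow> 'm \<Rightarrow> bool" where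
  "torsion_over \<Gamma> \<iota> m \<longleftrightarrow> (\<exists>k\<ge>1. nmult k m \<in> \<iota> ` \<Gamma>)"

definition torsion_values ::
    "'g set \<Rightarrow> ('g \<Rightarrow> 'm::comm_monoid_add) \<Rightarrow> ('e::field \<Rightarrow> 'm adj_infty) \<Rightarrow> bool" where
  "torsion_values \<Gamma> \<iota> w \<longleftrightarrow> (\<forall>x. x \<noteq> 0 \<longrightarrow> (\<exists>m. w x = Fin m \<and> torsion_over \<Gamma> \<iota> m))"

section \<open>Comparing values in the divisible hull\<close>

definition divisible_hull ::
    "'g::linordered_ab_group_add set \<Rightarrow> ('g \<Rightarrow> 'd::linordered_ab_group_add) \<Rightarrow> bool" where
  "divisible_hull \<Gamma> j \<longleftrightarrow>
     ordered_embedding \<Gamma> j \<and>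
     (\<forall>n\<ge>1. \<forall>d::'d. \<exists>e. nmult n e = d) \<and>
     (\<forall>d. torsion_over \<Gamma> j d)"

text \<open>
  The embedding over \<open>\<Gamma>\<close> of the elements of \<open>M\<close> that are torsion over \<open>\<Gamma>\<close> into the
  divisible hull: \<open>m\<close> with \<open>k m = \<gamma>\<close> goes to \<open>\<gamma> / k\<close>. The lemmas below show that it is
  well defined, additive, strictly monotone and over \<open>\<Gamma>\<close>, and that it is the only
  additive map over \<open>\<Gamma>\<close>. The torsion elements form a submonoid, which contains the submonoid
  generated by the values of a quasi-valuation with torsion values.
\<close>

definition hull_map ::
    "'g set \<Rightarrow> ('g \<Rightarrow> 'm::comm_monoid_add) \<Rightarrow> ('g \<Rightarrow> 'd::comm_monoid_add) \<Rightarrow> 'm \<Rightarrow> 'd" where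
  "hull_map \<Gamma> \<iota> j m = (THE d. \<exists>k\<ge>1. \<exists>\<gamma>\<in>\<Gamma>. nmult k m = \<iota> \<gamma> \<and> nmult k d = j \<gamma>)"

text \<open>
  \<open>u\<close> dominates \<open>w\<close>, where \<open>\<kappa>\<close> and \<open>\<iota>\<close> include the value group of \<open>v\<close> in the codomains
  of \<open>u\<close> and \<open>w\<close>, and \<open>j\<close> includes it in its divisible hull.
\<close>

definition dominates ::
    "('f::field \<Rightarrow> 'g::linordered_ab_group_add adj_infty) \<Rightarrow> ('g \<Rightarrow> 'd::linordered_ab_group_add)
      \<Rightarrow> ('g \<Rightarrow> 'h::linordered_ab_group_add) \<Rightarrow> ('e::field \<Rightarrow> 'h adj_infty)
      \<Rightarrow> ('g \<Rightarrow> 'm::{linorder,ordered_comm_monoid_add}) \<Rightarrow> ('e \<Rightarrow> 'm adj_infty) \<Rightarrow> bool" where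
  "dominates v j \<kappa> u \<iota> w \<longleftrightarrow>
     (\<forall>x. map_adj_infty (hull_map (value_group v) \<iota> j) (w x)
            \<le> map_adj_infty (hull_map (value_group v) \<kappa> j) (u x))"

lemma nmult_0 [simp]: "nmult 0 m = 0"
  and nmult_Suc [simp]: "nmult (Suc k) m = m + nmult k m"
  and nmult_1 [simp]: "nmult 1 m = m"
  by (simp_all add: nmult_def add.commute)

lemma nmult_add: "nmult k (a + b) = nmult k a + nmult k b"
  by (simp add: nmult_def sum.distrib)

lemma nmult_add_left: "nmult (k + l) a = nmult k a + nmult l a"
  by (induction k) (auto simp: add.assoc)

lemma nmult_mult: "nmult (k * l) a = nmult k (nmult l a)"
  by (induction k) (auto simp: nmult_add_left)

lemma nmult_mult': "nmult (k * l) a = nmult l (nmult k a)"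
  by (metis nmult_mult mult.commute)

lemma nmult_mono:
  fixes a b :: "'m::{linorder,ordered_comm_monoid_add}"
  shows "a \<le> b \<Longrightarrow> nmult k a \<le> nmult k b"
  by (induction k) (auto intro: add_mono)

lemma nmult_strict_mono:
  fixes a b :: "'g::linordered_ab_group_add"
  assumes "a < b" "k \<ge> 1"
  shows "nmult k a < nmult k b"
proof -
  obtain l where "k = Suc l" using assms(2) by (cases k) auto
  then show ?thesis using assms(1) nmult_mono[of a b l] by (auto intro: add_less_le_mono)
qed

lemma nmult_less_cancel:
  fixes a b :: "'g::linordered_ab_group_add"
  assumes "nmult k a < nmult k b"
  shows "a < b"
  using assms nmult_mono[of b a k] by (meson leD not_le)

lemma nmult_inj:
  fixes a b :: "'g::linordered_ab_group_add"
  assumes "nmult k a = nmult k b" "k \<ge> 1"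
  shows "a = b"
  using assms nmult_strict_mono[of _ _ k] by (metis less_irrefl linorder_neqE)

locale subgroup_with_hull =
  fixes \<Gamma> :: "'g::linordered_ab_group_add set"
    and \<iota> :: "'g \<Rightarrow> 'm::{linorder,ordered_comm_monoid_add}"
    and j :: "'g \<Rightarrow> 'd::linordered_ab_group_add"
  assumes zero_in: "0 \<in> \<Gamma>"
    and add_in: "a \<in> \<Gamma> \<Longrightarrow> b \<in> \<Gamma> \<Longrightarrow> a + b \<in> \<Gamma>"
    and minus_in: "a \<in> \<Gamma> \<Longrightarrow> - a \<in> \<Gamma>"
    and \<iota>: "ordered_embedding \<Gamma> \<iota>"
    and j: "divisible_hull \<Gamma> j"
begin

lemma embedding_nmult:
  assumes "ordered_embedding \<Gamma> \<phi>" "\<gamma> \<in> \<Gamma>"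
  shows "nmult k \<gamma> \<in> \<Gamma> \<and> \<phi> (nmult k \<gamma>) = nmult k (\<phi> \<gamma>)"
  using assms by (induction k) (auto simp: ordered_embedding_def zero_in add_in)

lemma embedding_eq_iff:
  assumes "ordered_embedding \<Gamma> \<phi>" "a \<in> \<Gamma>" "b \<in> \<Gamma>"
  shows "\<phi> a = \<phi> b \<longleftrightarrow> a = b"
  using assms by (auto simp: ordered_embedding_def dest: strict_mono_on_eqD)

lemma embedding_less:
  assumes "ordered_embedding \<Gamma> \<phi>" "a \<in> \<Gamma>" "b \<in> \<Gamma>" "a < b"
  shows "\<phi> a < \<phi> b"
  using assms by (auto simp: ordered_embedding_def strict_mono_on_def)

lemma embedding_j: "ordered_embedding \<Gamma> j"
  using j by (simp add: divisible_hull_def)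

lemma hull_map_unique:
  assumes "k \<ge> 1" "\<gamma> \<in> \<Gamma>" "nmult k m = \<iota> \<gamma>" "nmult k d = j \<gamma>"
    and "k' \<ge> 1" "\<gamma>' \<in> \<Gamma>" "nmult k' m = \<iota> \<gamma>'" "nmult k' d' = j \<gamma>'"
  shows "d = d'"
proof -
  have "\<iota> (nmult k' \<gamma>) = \<iota> (nmult k \<gamma>')"
    using assms embedding_nmult[OF \<iota>] by (metis nmult_mult nmult_mult')
  then have "nmult k' \<gamma> = nmult k \<gamma>'"
    using embedding_eq_iff[OF \<iota>] embedding_nmult[OF \<iota>] assms by blast
  then have "nmult (k * k') d = nmult (k * k') d'"
    using assms embedding_nmult[OF embedding_j] by (metis nmult_mult nmult_mult')
  then show ?thesis
    using assms nmult_inj[of "k * k'" d d'] by auto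
qed

lemma hull_map_eqI:
  assumes "k \<ge> 1" "\<gamma> \<in> \<Gamma>" "nmult k m = \<iota> \<gamma>" "nmult k d = j \<gamma>"
  shows "hull_map \<Gamma> \<iota> j m = d"
  unfolding hull_map_def
proof (rule the_equality)
  show "\<exists>k\<ge>1. \<exists>\<gamma>\<in>\<Gamma>. nmult k m = \<iota> \<gamma> \<and> nmult k d = j \<gamma>"
    using assms by blast
next
  fix d' assume "\<exists>k\<ge>1. \<exists>\<gamma>\<in>\<Gamma>. nmult k m = \<iota> \<gamma> \<and> nmult k d' = j \<gamma>"
  then show "d' = d" using hull_map_unique assms by metis
qed

lemma hull_mapE:
  assumes "torsion_over \<Gamma> \<iota> m"
  obtains k \<gamma> where "k \<ge> 1" "\<gamma> \<in> \<Gamma>" "nmult k m = \<iota> \<gamma>" "nmult k (hull_map \<Gamma> \<iota> j m) = j \<gamma>"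
proof -
  obtain k \<gamma> where *: "k \<ge> 1" "\<gamma> \<in> \<Gamma>" "nmult k m = \<iota> \<gamma>"
    using assms by (auto simp: torsion_over_def)
  obtain d where "nmult k d = j \<gamma>"
    using j *(1) unfolding divisible_hull_def by blast
  then show ?thesis using that * hull_map_eqI by metis
qed

lemma hull_map_over:
  assumes "\<gamma> \<in> \<Gamma>"
  shows "hull_map \<Gamma> \<iota> j (\<iota> \<gamma>) = j \<gamma>"
  using assms hull_map_eqI[of 1 \<gamma>] by simp

lemma
  assumes "torsion_over \<Gamma> \<iota> m" "torsion_over \<Gamma> \<iota> m'"
  shows torsion_over_add: "torsion_over \<Gamma> \<iota> (m + m')"
    and hull_map_add:
      "hull_map \<Gamma> \<iota> j (m + m') = hull_map \<Gamma> \<iota> j m + hull_map \<Gamma> \<iota> j m'"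
proof -
  let ?h = "hull_map \<Gamma> \<iota> j"
  obtain k \<gamma> where k: "k \<ge> 1" "\<gamma> \<in> \<Gamma>" "nmult k m = \<iota> \<gamma>" "nmult k (?h m) = j \<gamma>"
    using assms(1) by (rule hull_mapE)
  obtain l \<delta> where l: "l \<ge> 1" "\<delta> \<in> \<Gamma>" "nmult l m' = \<iota> \<delta>" "nmult l (?h m') = j \<delta>"
    using assms(2) by (rule hull_mapE)
  let ?\<epsilon> = "nmult l \<gamma> + nmult k \<delta>"
  have in\<Gamma>: "nmult l \<gamma> \<in> \<Gamma>" "nmult k \<delta> \<in> \<Gamma>" "?\<epsilon> \<in> \<Gamma>"
    using k l embedding_nmult[OF \<iota>] add_in by blast+
  have 1: "nmult (k * l) (m + m') = \<iota> ?\<epsilon>"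
    using in\<Gamma> k l \<iota> embedding_nmult[OF \<iota>]
    by (simp add: nmult_add nmult_mult'[of k l m] nmult_mult[of k l m'] ordered_embedding_def)
  have 2: "nmult (k * l) (?h m + ?h m') = j ?\<epsilon>"
    using in\<Gamma> k l embedding_j embedding_nmult[OF embedding_j]
    by (simp add: nmult_add nmult_mult'[of k l "?h m"] nmult_mult[of k l "?h m'"] ordered_embedding_def)
  have kl: "k * l \<ge> 1" using k l by simp
  show "torsion_over \<Gamma> \<iota> (m + m')"
    using kl 1 in\<Gamma>(3) unfolding torsion_over_def by blast
  show "?h (m + m') = ?h m + ?h m'"
    by (rule hull_map_eqI[OF kl in\<Gamma>(3) 1 2])
qed

lemma torsion_invertible:
  assumes "torsion_over \<Gamma> \<iota> m"
  obtains m' where "m + m' = 0"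
proof -
  obtain k \<gamma> where k: "k \<ge> 1" "\<gamma> \<in> \<Gamma>" "nmult k m = \<iota> \<gamma>"
    using assms by (rule hull_mapE)
  then obtain l where "k = Suc l" by (cases k) auto
  moreover have "\<iota> \<gamma> + \<iota> (- \<gamma>) = 0"
    using \<iota> k(2) minus_in by (metis ordered_embedding_def add.right_inverse)
  ultimately have "m + (nmult l m + \<iota> (- \<gamma>)) = 0"
    using k(3) by (simp add: add.assoc[symmetric])
  then show ?thesis by (rule that)
qed

lemma torsion_nmult_inj:
  assumes "torsion_over \<Gamma> \<iota> m" "m \<le> m'" "nmult k m = nmult k m'" "k \<ge> 1"
  shows "m = m'"
proof -
  obtain n where n: "m + n = 0" using assms(1) by (rule torsion_invertible)
  obtain l where l: "k = Suc l" using assms(4) by (cases k) auto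
  have "m' + nmult l m \<le> m' + nmult l m'"
    using nmult_mono[OF assms(2)] by (rule add_left_mono)
  also have "\<dots> = m + nmult l m" using assms(3) l by simp
  finally have "m' + nmult l m + nmult l n \<le> m + nmult l m + nmult l n"
    by (rule add_right_mono)
  moreover have "nmult l m + nmult l n = 0"
    using n by (metis nmult_add nmult_def sum.neutral_const)
  ultimately have "m' \<le> m" by (simp add: add.assoc)
  then show ?thesis using assms(2) by simp
qed

lemma hull_map_strict_mono:
  assumes "torsion_over \<Gamma> \<iota> m" "torsion_over \<Gamma> \<iota> m'" "m < m'"
  shows "hull_map \<Gamma> \<iota> j m < hull_map \<Gamma> \<iota> j m'"
proof -
  let ?h = "hull_map \<Gamma> \<iota> j"
  obtain k \<gamma> where k: "k \<ge> 1" "\<gamma> \<in> \<Gamma>" "nmult k m = \<iota> \<gamma>" "nmult k (?h m) = j \<gamma>"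
    using assms(1) by (rule hull_mapE)
  obtain l \<delta> where l: "l \<ge> 1" "\<delta> \<in> \<Gamma>" "nmult l m' = \<iota> \<delta>" "nmult l (?h m') = j \<delta>"
    using assms(2) by (rule hull_mapE)
  have in\<Gamma>: "nmult l \<gamma> \<in> \<Gamma>" "nmult k \<delta> \<in> \<Gamma>"
    using k l embedding_nmult[OF \<iota>] by blast+
  have m: "nmult (k * l) m = \<iota> (nmult l \<gamma>)" "nmult (k * l) m' = \<iota> (nmult k \<delta>)"
    using k l embedding_nmult[OF \<iota>] by (metis nmult_mult nmult_mult')+
  have h: "nmult (k * l) (?h m) = j (nmult l \<gamma>)" "nmult (k * l) (?h m') = j (nmult k \<delta>)"
    using k l embedding_nmult[OF embedding_j] by (metis nmult_mult nmult_mult')+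
  have "nmult (k * l) m \<noteq> nmult (k * l) m'"
    using torsion_nmult_inj[of m m' "k * l"] assms k l by (metis less_imp_le less_irrefl mult_le_mono mult_1)
  moreover have "nmult (k * l) m \<le> nmult (k * l) m'"
    using assms by (intro nmult_mono) simp
  ultimately have "\<iota> (nmult l \<gamma>) < \<iota> (nmult k \<delta>)" using m by simp
  then have "nmult l \<gamma> < nmult k \<delta>"
    using embedding_less[OF \<iota> in\<Gamma>(2,1)] by (metis less_asym less_irrefl linorder_neqE)
  then show ?thesis
    using embedding_less[OF embedding_j in\<Gamma>] h nmult_less_cancel by metis
qed

lemma hull_map_only:
  assumes over: "\<And>\<gamma>. \<gamma> \<in> \<Gamma> \<Longrightarrow> \<phi> (\<iota> \<gamma>) = j \<gamma>"
    and add: "\<And>a b. a \<in> S \<Longrightarrow> b \<in> S \<Longrightarrow> a + b \<in> S \<and> \<phi> (a + b) = \<phi> a + \<phi> b"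
    and "m \<in> S" "torsion_over \<Gamma> \<iota> m"
  shows "\<phi> m = hull_map \<Gamma> \<iota> j m"
proof -
  have *: "nmult (Suc k) m \<in> S \<and> \<phi> (nmult (Suc k) m) = nmult (Suc k) (\<phi> m)" for k
    using assms(3) add by (induction k) auto
  obtain k \<gamma> where k: "k \<ge> 1" "\<gamma> \<in> \<Gamma>" "nmult k m = \<iota> \<gamma>"
    using assms(4) by (rule hull_mapE)
  then have "nmult k (\<phi> m) = j \<gamma>"
    using *[of "k - 1"] over by simp
  then show ?thesis using hull_map_eqI[OF k] by simp
qed

end

lemma subgroup_with_hullI:
  assumes v: "valuation v"
    and "ordered_embedding (value_group v) \<iota>" "divisible_hull (value_group v) j"
  shows "subgroup_with_hull (value_group v) \<iota> j"
proof
  have one: "v 1 = Fin 0"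
  proof -
    obtain g where g: "v 1 = Fin g" using v by (cases "v 1") (auto simp: valuation_def)
    have "v (1 * 1) = v 1 + v 1" using v unfolding valuation_def by blast
    then show ?thesis using g by simp
  qed
  then show "0 \<in> value_group v" by (auto simp: value_group_def intro!: exI[of _ 1])
  fix a assume "a \<in> value_group v"
  then obtain x where x: "x \<noteq> 0" "v x = Fin a" by (auto simp: value_group_def)
  {
    fix b assume "b \<in> value_group v"
    then obtain y where y: "y \<noteq> 0" "v y = Fin b" by (auto simp: value_group_def)
    have "v (x * y) = Fin (a + b)" using v x y by (simp add: valuation_def)
    then show "a + b \<in> value_group v" using x y by (auto simp: value_group_def intro!: exI[of _ "x * y"])
  }
  have "v (inverse x) \<noteq> Infty" using v x by (auto simp: valuation_def)
  then obtain b where b: "v (inverse x) = Fin b" by (cases "v (inverse x)") auto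
  have "v (x * inverse x) = v x + v (inverse x)" using v unfolding valuation_def by blast
  then have "a + b = 0" using one x b by simp
  then have "b = - a" by (simp add: eq_neg_iff_add_eq_0 add.commute)
  then show "- a \<in> value_group v" using b x by (auto simp: value_group_def intro!: exI[of _ "inverse x"])
qed (use assms in auto)

end

theory Submission
  imports Defs "HOL-Computational_Algebra.Polynomial"
begin

text \<open>
  Since \<open>O\<^sub>w\<close> lies over \<open>O\<^sub>v\<close>, the elements \<open>x\<close> with \<open>w x \<ge> v c\<close> for some \<open>c\<close> with \<open>v c > 0\<close>
  form a proper ideal \<open>I\<close> of \<open>O\<^sub>w\<close> that contains the maximal ideal of \<open>O\<^sub>v\<close>. By Chevalley's theorem
  there is a valuation ring \<open>V\<close> of \<open>E\<close> that contains \<open>O\<^sub>w\<close> and in which the elements of \<open>I\<close> are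
  nonunits, so \<open>V\<close> lies over \<open>O\<^sub>v\<close>. As \<open>E\<close> is algebraic over \<open>F\<close>, every \<open>x \<noteq> 0\<close> has a power \<open>x ^ k\<close>
  associated in \<open>V\<close> to some \<open>a \<in> F\<close>, and \<open>u x = v a / k\<close> is a valuation with ring \<open>V\<close>.
  Finally, if \<open>O\<^sub>u\<close> contains \<open>O\<^sub>w\<close> and \<open>k (w x) = v a\<close>, then \<open>w (x ^ k / a) \<ge> 0\<close>, hence
  \<open>k (u x) \<ge> v a = k (w x)\<close>.
\<close>

section \<open>Chevalley's extension theorem\<close>

locale subring_of =
  fixes B :: "'a::comm_ring_1 set"
  assumes one_in: "1 \<in> B"
    and diff_in: "x \<in> B \<Longrightarrow> y \<in> B \<Longrightarrow> x - y \<in> B"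
    and mult_in: "x \<in> B \<Longrightarrow> y \<in> B \<Longrightarrow> x * y \<in> B"
begin

lemma zero_in: "0 \<in> B"
  using diff_in[OF one_in one_in] by simp

lemma minus_in: "x \<in> B \<Longrightarrow> - x \<in> B"
  using diff_in[OF zero_in] by fastforce

lemma add_in: "x \<in> B \<Longrightarrow> y \<in> B \<Longrightarrow> x + y \<in> B"
  using diff_in[OF _ minus_in] by fastforce

lemma power_in: "x \<in> B \<Longrightarrow> x ^ n \<in> B"
  by (induction n) (auto simp: one_in mult_in)

end

text \<open>Since \<open>inverse 0 = 0\<close>, the condition for \<open>x = 0\<close> says only
  that \<open>0 \<in> V\<close>.\<close>

locale valuation_subring = subring_of V for V :: "'a::field set" +
  assumes total: "x \<in> V \<or> inverse x \<in> V"

text \<open>Ring and ideal are bundled because Chevalley's argument enlarges both at once;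
  \<open>1 \<notin> J\<close> keeps the elements of \<open>J\<close> from becoming units.\<close>

locale proper_ideal = subring_of B for B :: "'a::comm_ring_1 set" +
  fixes J :: "'a set"
  assumes ideal_subset: "J \<subseteq> B"
    and ideal_zero: "0 \<in> J"
    and ideal_add: "x \<in> J \<Longrightarrow> y \<in> J \<Longrightarrow> x + y \<in> J"
    and ideal_mult: "b \<in> B \<Longrightarrow> x \<in> J \<Longrightarrow> b * x \<in> J"
    and one_notin: "1 \<notin> J"
begin

lemma ideal_minus: "x \<in> J \<Longrightarrow> - x \<in> J"
  using ideal_mult[OF minus_in[OF one_in]] by fastforce

lemma ideal_diff: "x \<in> J \<Longrightarrow> y \<in> J \<Longrightarrow> x - y \<in> J"
  using ideal_add[OF _ ideal_minus] by fastforce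

lemma ideal_sum: "(\<And>i. i \<in> I \<Longrightarrow> f i \<in> J) \<Longrightarrow> sum f I \<in> J"
  by (induction I rule: infinite_finite_induct) (auto simp: ideal_zero ideal_add)

lemma coeff_mult_ideal:
  assumes "\<And>i. coeff p i \<in> B" "\<And>i. coeff q i \<in> J"
  shows "coeff (p * q) i \<in> J"
  unfolding coeff_mult using assms by (intro ideal_sum ideal_mult)

text \<open>The two sets are the ring \<open>B[x]\<close> and its ideal generated by
  \<open>J\<close>. The hypothesis says exactly that this ideal is still proper.\<close>

lemma adjoin:
  assumes "\<And>p. (\<And>i. coeff p i \<in> J) \<Longrightarrow> poly p x \<noteq> 1"
  shows "proper_ideal {poly p x | p. \<forall>i. coeff p i \<in> B} {poly p x | p. \<forall>i. coeff p i \<in> J}"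
proof
  show "1 \<in> {poly p x | p. \<forall>i. coeff p i \<in> B}"
    by (rule CollectI, rule exI[of _ 1]) (auto simp: one_in zero_in coeff_1)
next
  fix a b assume "a \<in> {poly p x | p. \<forall>i. coeff p i \<in> B}" "b \<in> {poly p x | p. \<forall>i. coeff p i \<in> B}"
  then obtain p q where pq: "a = poly p x" "b = poly q x"
    "\<And>i. coeff p i \<in> B" "\<And>i. coeff q i \<in> B" by blast
  have "coeff (p - q) i \<in> B" "coeff (p * q) i \<in> B" for i
    using pq coeff_mult_semiring_closed[of B p q, OF zero_in add_in mult_in] by (auto simp: diff_in)
  then show "a - b \<in> {poly p x | p. \<forall>i. coeff p i \<in> B}" "a * b \<in> {poly p x | p. \<forall>i. coeff p i \<in> B}"
    unfolding pq poly_diff[symmetric] poly_mult[symmetric] by blast+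
next
  show "{poly p x | p. \<forall>i. coeff p i \<in> J} \<subseteq> {poly p x | p. \<forall>i. coeff p i \<in> B}"
    using ideal_subset by blast
  show "0 \<in> {poly p x | p. \<forall>i. coeff p i \<in> J}"
    by (rule CollectI, rule exI[of _ 0]) (auto simp: ideal_zero)
  show "1 \<notin> {poly p x | p. \<forall>i. coeff p i \<in> J}"
    using assms by force
next
  fix a b assume "a \<in> {poly p x | p. \<forall>i. coeff p i \<in> J}" "b \<in> {poly p x | p. \<forall>i. coeff p i \<in> J}"
  then obtain p q where pq: "a = poly p x" "b = poly q x"
    "\<And>i. coeff p i \<in> J" "\<And>i. coeff q i \<in> J" by blast
  have "coeff (p + q) i \<in> J" for i using pq by (simp add: ideal_add)
  then show "a + b \<in> {poly p x | p. \<forall>i. coeff p i \<in> J}"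
    unfolding pq poly_add[symmetric] by blast
next
  fix a b assume "a \<in> {poly p x | p. \<forall>i. coeff p i \<in> B}" "b \<in> {poly p x | p. \<forall>i. coeff p i \<in> J}"
  then obtain p q where pq: "a = poly p x" "b = poly q x"
    "\<And>i. coeff p i \<in> B" "\<And>i. coeff q i \<in> J" by blast
  then have "coeff (p * q) i \<in> J" for i by (intro coeff_mult_ideal)
  then show "a * b \<in> {poly p x | p. \<forall>i. coeff p i \<in> J}"
    unfolding pq poly_mult[symmetric] by blast
qed

end

text \<open>
  If \<open>1 = \<Sum> c i * x ^ i\<close> has degree \<open>n\<close> and \<open>1 = \<Sum> d i * x ^ - i\<close> has degree \<open>m \<le> n\<close>, then
  multiplying the first relation by \<open>1 - d 0\<close> and eliminating \<open>(1 - d 0) * x ^ n\<close> with the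
  second one lowers \<open>n\<close>.
\<close>

lemma lower_degree:
  fixes x :: "'a::field"
  assumes "proper_ideal B J"
    and p: "\<And>i. coeff p i \<in> J" "poly p x = 1"
    and q: "\<And>i. coeff q i \<in> J" "poly q (inverse x) = 1"
    and deg: "degree q \<le> degree p"
  obtains p' where "\<And>i. coeff p' i \<in> J" "poly p' x = 1" "degree p' < degree p"
proof -
  interpret proper_ideal B J by fact
  define n m d c where "n = degree p" and "m = degree q" and "d = coeff q 0" and "c = coeff p n"
  \<comment> \<open>By the relation for \<open>inverse x\<close>, \<open>reflect_poly q\<close> has
    the value \<open>x ^ m\<close> at \<open>x\<close>, so \<open>s\<close> vanishes there. Its
    coefficient at \<open>n\<close> is \<open>1 - d\<close>, and those beyond are 0, so subtracting
    \<open>smult c s\<close> cancels the leading term of \<open>smult (1 - d) p\<close>. The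
    constant \<open>d\<close> restores the value 1.\<close>
  define s where "s = monom 1 (n - m) * (monom 1 m - reflect_poly q)"
  define p' where "p' = [:d:] + smult (1 - d) p - smult c s"
  \<comment> \<open>A positive \<open>n\<close> ensures that the constant \<open>d\<close> does not
    disturb the coefficient at \<open>n\<close>.\<close>
  have n0: "n > 0"
  proof (rule ccontr)
    assume "\<not> n > 0"
    then obtain a where "p = [:a:]" unfolding n_def by (metis degree_eq_zeroE not_gr_zero)
    then show False using p(1)[of 0] p(2) one_notin by simp
  qed
  have x0: "x \<noteq> 0"
  proof
    assume "x = 0"
    then have "coeff q 0 = 1" using q(2) by (simp add: poly_0_coeff_0)
    then show False using q(1)[of 0] one_notin by simp
  qed
  have dJ: "d \<in> J" and cJ: "c \<in> J" using p q by (auto simp: d_def c_def)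
  have dB: "1 - d \<in> B" using dJ ideal_subset one_in diff_in by blast
  have sB: "coeff s i \<in> B" for i
  proof -
    have "coeff (monom 1 m) k \<in> B" "coeff (reflect_poly q) k \<in> B" for k
      using q(1) ideal_subset by (auto simp: coeff_reflect_poly zero_in one_in)
    then have "coeff (monom 1 m - reflect_poly q) k \<in> B" for k by (simp add: diff_in)
    then show ?thesis unfolding s_def
      using coeff_mult_semiring_closed[of B, OF zero_in add_in mult_in]
      by (simp add: coeff_monom_mult zero_in)
  qed
  have coeffJ: "coeff p' i \<in> J" for i
    using p(1) dJ cJ dB sB ideal_mult[of "coeff s i" c]
    by (cases i) (auto simp: p'_def mult.commute intro!: ideal_add ideal_diff ideal_mult ideal_zero)
  have "poly (reflect_poly q) x = x ^ m"
    using x0 q(2) by (simp add: poly_reflect_poly_nz m_def)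
  then have "poly p' x = 1" using p(2) by (simp add: p'_def s_def poly_monom)
  moreover have "degree p' < n"
  proof (rule degree_lessI)
    show "p' \<noteq> 0 \<or> n > 0" using n0 by simp
    show "\<forall>k\<ge>n. coeff p' k = 0"
    proof (intro allI impI)
      fix k assume k: "k \<ge> n"
      have m: "m \<le> n" using deg by (simp add: m_def n_def)
      have s: "coeff s k = (if k = n then 1 - d else 0)"
        using k m by (auto simp: s_def coeff_monom_mult coeff_reflect_poly m_def d_def)
      show "coeff p' k = 0"
      proof (cases "k = n")
        case True
        then show ?thesis using n0 s by (cases n) (auto simp: p'_def c_def)
      next
        case False
        then have "coeff p k = 0" using k by (simp add: n_def coeff_eq_0)
        then show ?thesis using False k n0 s by (cases k) (auto simp: p'_def)
      qed
    qed
  qed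
  ultimately show ?thesis using coeffJ by (intro that[of p']) (simp_all add: n_def)
qed

text \<open>If \<open>J\<close> generated the unit ideal both in \<open>B[x]\<close> and in
  \<open>B[inverse x]\<close>, take relations of least degree on both sides. Then
  \<open>lower_degree\<close> shortens the one of larger degree, with \<open>x\<close> and
  \<open>inverse x\<close> exchanged if necessary.\<close>

lemma adjoin_or_adjoin_inverse:
  fixes x :: "'a::field"
  assumes "proper_ideal B J"
  shows "(\<forall>p. (\<forall>i. coeff p i \<in> J) \<longrightarrow> poly p x \<noteq> 1) \<or>
         (\<forall>p. (\<forall>i. coeff p i \<in> J) \<longrightarrow> poly p (inverse x) \<noteq> 1)"
proof (rule ccontr)
  let ?P = "\<lambda>x p. (\<forall>i. coeff p i \<in> J) \<and> poly p x = 1"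
  assume "\<not> ?thesis"
  then obtain p0 q0 where pq0: "?P x p0" "?P (inverse x) q0" by blast
  obtain p where p: "?P x p" "\<And>p'. ?P x p' \<Longrightarrow> degree p \<le> degree p'"
    using ex_has_least_nat[of "?P x", OF pq0(1), of degree] by blast
  obtain q where q: "?P (inverse x) q" "\<And>q'. ?P (inverse x) q' \<Longrightarrow> degree q \<le> degree q'"
    using ex_has_least_nat[of "?P (inverse x)", OF pq0(2), of degree] by blast
  show False
  proof (cases "degree q \<le> degree p")
    case True
    then obtain p' where "?P x p'" "degree p' < degree p"
      using lower_degree[OF assms, of p x q] p(1) q(1) by metis
    then show False using p(2)[of p'] by simp
  next
    case False
    then obtain q' where "?P (inverse x) q'" "degree q' < degree q"
      using lower_degree[OF assms, of q "inverse x" p] p(1) q(1) by (metis inverse_inverse_eq nat_le_linear)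
    then show False using q(2)[of q'] by simp
  qed
qed

section \<open>Maximal pairs and Zorn's lemma\<close>

text \<open>If \<open>J\<close> stays proper in \<open>B[x]\<close>, then \<open>adjoin\<close>
  gives a pair above \<open>(B, J)\<close>, and maximality forces \<open>x \<in> B\<close>. This
  applies to \<open>x\<close> or to \<open>inverse x\<close>.\<close>

lemma maximal_proper_ideal:
  fixes B J :: "'a::field set"
  assumes pi: "proper_ideal B J"
    and max: "\<And>B' J'. proper_ideal B' J' \<Longrightarrow> B \<subseteq> B' \<Longrightarrow> J \<subseteq> J' \<Longrightarrow> B' = B"
  shows "valuation_subring B"
proof -
  interpret proper_ideal B J by fact
  have *: "x \<in> B" if x: "\<forall>p. (\<forall>i. coeff p i \<in> J) \<longrightarrow> poly p x \<noteq> 1" for x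
  proof -
    let ?B = "{poly p x | p. \<forall>i. coeff p i \<in> B}"
    let ?J = "{poly p x | p. \<forall>i. coeff p i \<in> J}"
    have const: "\<forall>i. coeff [:a:] i \<in> S" if "a \<in> S" "0 \<in> S" for a and S :: "'a set"
      using that by (auto simp: coeff_pCons split: nat.split)
    have "B \<subseteq> ?B"
    proof
      fix a assume "a \<in> B"
      then show "a \<in> ?B" using const[OF _ zero_in] by (intro CollectI exI[of _ "[:a:]"]) auto
    qed
    moreover have "J \<subseteq> ?J"
    proof
      fix a assume "a \<in> J"
      then show "a \<in> ?J" using const[OF _ ideal_zero] by (intro CollectI exI[of _ "[:a:]"]) auto
    qed
    ultimately have "?B = B" using max[of ?B ?J] adjoin[of x] x by blast
    moreover have "x \<in> ?B"
      by (rule CollectI, rule exI[of _ "[:0, 1:]"])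
        (auto simp: coeff_pCons zero_in one_in split: nat.split)
    ultimately show ?thesis by simp
  qed
  show ?thesis
    by unfold_locales (use adjoin_or_adjoin_inverse[OF pi] * in blast)
qed

text \<open>Zorn's lemma yields a maximal pair above \<open>(A, I)\<close>, whose ring is a
  valuation ring. The last conclusion says that the elements of \<open>I\<close> stay nonunits; it
  spares 0 because \<open>inverse 0 = 0\<close> lies in \<open>V\<close>.\<close>

lemma chevalley:
  fixes A I :: "'a::field set"
  assumes "proper_ideal A I"
  obtains V where "valuation_subring V" "A \<subseteq> V" "\<And>x. x \<in> I \<Longrightarrow> inverse x \<in> V \<Longrightarrow> x = 0"
proof -
  \<comment> \<open>A pair \<open>(B, J)\<close> is encoded as the set \<open>B \<times> {True} \<union> J \<times> {False}\<close>.\<close>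
  define ring where "ring S = {x::'a. (x, True) \<in> S}" for S
  define ideal where "ideal S = {x::'a. (x, False) \<in> S}" for S
  define pair where "pair B J = B \<times> {True} \<union> J \<times> {False}" for B J :: "'a set"
  have pair [simp]: "ring (pair B J) = B" "ideal (pair B J) = J" for B J
    by (auto simp: ring_def ideal_def pair_def)
  have le: "S \<subseteq> T \<longleftrightarrow> ring S \<subseteq> ring T \<and> ideal S \<subseteq> ideal T" for S T
  proof safe
    fix x b assume "ring S \<subseteq> ring T" "ideal S \<subseteq> ideal T" "(x, b) \<in> S"
    then show "(x, b) \<in> T" by (cases b) (auto simp: ring_def ideal_def)
  qed (auto simp: ring_def ideal_def)
  define \<A> where "\<A> = {S. proper_ideal (ring S) (ideal S) \<and> A \<subseteq> ring S \<and> I \<subseteq> ideal S}"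
  have "\<exists>M\<in>\<A>. \<forall>X\<in>\<A>. M \<subseteq> X \<longrightarrow> X = M"
  proof (rule subset_Zorn_nonempty)
    have "pair A I \<in> \<A>" using assms by (simp add: \<A>_def)
    then show "\<A> \<noteq> {}" by blast
  next
    fix \<C> assume \<C>: "\<C> \<noteq> {}" "subset.chain \<A> \<C>"
    have pi: "proper_ideal (ring S) (ideal S)" and AI: "A \<subseteq> ring S" "I \<subseteq> ideal S" if "S \<in> \<C>" for S
      using \<C>(2) that by (auto simp: \<A>_def subset.chain_def)
    have ring: "x \<in> ring (\<Union>\<C>) \<longleftrightarrow> (\<exists>S\<in>\<C>. x \<in> ring S)"
      and ideal: "x \<in> ideal (\<Union>\<C>) \<longleftrightarrow> (\<exists>S\<in>\<C>. x \<in> ideal S)" for x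
      by (auto simp: ring_def ideal_def)
    \<comment> \<open>Any two members of the chain lie in one of them, so closure conditions on two
      elements of the union can be checked inside a single pair.\<close>
    have common: "\<exists>S\<in>\<C>. ring S1 \<subseteq> ring S \<and> ideal S1 \<subseteq> ideal S \<and> ring S2 \<subseteq> ring S \<and> ideal S2 \<subseteq> ideal S"
      if "S1 \<in> \<C>" "S2 \<in> \<C>" for S1 S2
    proof -
      have "S1 \<subseteq> S2 \<or> S2 \<subseteq> S1" using \<C>(2) that by (simp add: subset_chain_def)
      then show ?thesis using that unfolding le by blast
    qed
    obtain S0 where S0: "S0 \<in> \<C>" using \<C>(1) by blast
    have "proper_ideal (ring (\<Union>\<C>)) (ideal (\<Union>\<C>))"
    proof
      show "1 \<in> ring (\<Union>\<C>)"
        using subring_of.one_in[OF proper_ideal.axioms(1)[OF pi[OF S0]]] S0 unfolding ring by blast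
      show "0 \<in> ideal (\<Union>\<C>)"
        using proper_ideal.ideal_zero[OF pi[OF S0]] S0 unfolding ideal by blast
      show "1 \<notin> ideal (\<Union>\<C>)"
        using proper_ideal.one_notin[OF pi] unfolding ideal by blast
      show "ideal (\<Union>\<C>) \<subseteq> ring (\<Union>\<C>)"
      proof
        fix x assume "x \<in> ideal (\<Union>\<C>)"
        then obtain S where S: "S \<in> \<C>" "x \<in> ideal S" unfolding ideal by blast
        then have "x \<in> ring S" using proper_ideal.ideal_subset[OF pi[OF S(1)]] by blast
        then show "x \<in> ring (\<Union>\<C>)" using S(1) unfolding ring by blast
      qed
    next
      fix x y assume "x \<in> ring (\<Union>\<C>)" "y \<in> ring (\<Union>\<C>)"
      then obtain S1 S2 where S12: "S1 \<in> \<C>" "x \<in> ring S1" "S2 \<in> \<C>" "y \<in> ring S2"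
        unfolding ring by blast
      obtain S where S: "S \<in> \<C>" "x \<in> ring S" "y \<in> ring S"
        using common[OF S12(1,3)] S12(2,4) by blast
      interpret proper_ideal "ring S" "ideal S" by (rule pi[OF S(1)])
      show "x - y \<in> ring (\<Union>\<C>)" "x * y \<in> ring (\<Union>\<C>)"
        using S(1) diff_in[OF S(2,3)] mult_in[OF S(2,3)] unfolding ring by blast+
    next
      fix x y assume "x \<in> ideal (\<Union>\<C>)" "y \<in> ideal (\<Union>\<C>)"
      then obtain S1 S2 where S12: "S1 \<in> \<C>" "x \<in> ideal S1" "S2 \<in> \<C>" "y \<in> ideal S2"
        unfolding ideal by blast
      obtain S where S: "S \<in> \<C>" "x \<in> ideal S" "y \<in> ideal S"
        using common[OF S12(1,3)] S12(2,4) by blast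
      then show "x + y \<in> ideal (\<Union>\<C>)"
        using S(1) proper_ideal.ideal_add[OF pi[OF S(1)] S(2,3)] unfolding ideal by blast
    next
      fix x y assume "x \<in> ring (\<Union>\<C>)" "y \<in> ideal (\<Union>\<C>)"
      then obtain S1 S2 where S12: "S1 \<in> \<C>" "x \<in> ring S1" "S2 \<in> \<C>" "y \<in> ideal S2"
        unfolding ideal ring by blast
      obtain S where S: "S \<in> \<C>" "x \<in> ring S" "y \<in> ideal S"
        using common[OF S12(1,3)] S12(2,4) by blast
      then show "x * y \<in> ideal (\<Union>\<C>)"
        using S(1) proper_ideal.ideal_mult[OF pi[OF S(1)] S(2,3)] unfolding ideal by blast
    qed
    then show "\<Union>\<C> \<in> \<A>"
      using AI[OF S0] S0 by (auto simp: \<A>_def ring ideal intro!: bexI[of _ S0])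
  qed
  then obtain M where M: "M \<in> \<A>" "\<And>X. X \<in> \<A> \<Longrightarrow> M \<subseteq> X \<Longrightarrow> X = M" by blast
  then have pi: "proper_ideal (ring M) (ideal M)" and AI: "A \<subseteq> ring M" "I \<subseteq> ideal M"
    by (auto simp: \<A>_def)
  have "valuation_subring (ring M)"
  proof (rule maximal_proper_ideal[OF pi])
    fix B' J' assume "proper_ideal B' J'" "ring M \<subseteq> B'" "ideal M \<subseteq> J'"
    then have "pair B' J' = M" using AI by (intro M(2)) (auto simp: \<A>_def le)
    then show "B' = ring M" using pair(1)[of B' J'] by simp
  qed
  moreover have "x = 0" if "x \<in> I" "inverse x \<in> ring M" for x
  proof (rule ccontr)
    assume "x \<noteq> 0"
    then have "inverse x * x = 1" by simp
    moreover have "inverse x * x \<in> ideal M"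
      using proper_ideal.ideal_mult[OF pi that(2)] that(1) AI(2) by blast
    ultimately have "1 \<in> ideal M" by simp
    then show False using proper_ideal.one_notin[OF pi] by simp
  qed
  ultimately show ?thesis using that AI(1) by blast
qed

section \<open>Units of valuation rings and torsion\<close>

context valuation_subring
begin

text \<open>The clause \<open>x \<noteq> 0\<close> matters because 0 is its own inverse
  here.\<close>

definition unit :: "'a \<Rightarrow> bool" where
  "unit x \<longleftrightarrow> x \<noteq> 0 \<and> x \<in> V \<and> inverse x \<in> V"

lemma unit_mult: "unit x \<Longrightarrow> unit y \<Longrightarrow> unit (x * y)"
  by (simp add: unit_def mult_in)

lemma unit_inverse: "unit x \<Longrightarrow> unit (inverse x)"
  by (simp add: unit_def)

lemma unit_power: "unit x \<Longrightarrow> unit (x ^ n)"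
  by (simp add: unit_def power_in flip: power_inverse)

lemma mult_unit_in_iff:
  assumes "unit y"
  shows "x * y \<in> V \<longleftrightarrow> x \<in> V"
proof
  assume "x * y \<in> V"
  then have "x * y * inverse y \<in> V"
    using assms by (intro mult_in[of "x * y"]) (simp_all add: unit_def)
  moreover have "x * y * inverse y = x" using assms by (simp add: unit_def)
  ultimately show "x \<in> V" using assms by (simp add: unit_def)
qed (use assms in \<open>simp add: unit_def mult_in\<close>)

text \<open>An instance of integral closedness: if \<open>x\<close> were outside \<open>V\<close>,
  then \<open>inverse x\<close> would lie in \<open>V\<close>, and so would
  \<open>x = x ^ n * inverse x ^ (n - 1)\<close>.\<close>

lemma power_in_iff:
  assumes "n \<ge> 1"
  shows "x ^ n \<in> V \<longleftrightarrow> x \<in> V"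
proof
  assume xn: "x ^ n \<in> V"
  show "x \<in> V"
  proof (rule ccontr)
    assume x: "x \<notin> V"
    then have "x \<noteq> 0" "inverse x \<in> V" using zero_in total by auto
    obtain l where "n = Suc l" using assms by (cases n) auto
    then have "x = x ^ n * inverse x ^ l"
      using \<open>x \<noteq> 0\<close> by (simp add: power_inverse)
    then show False using x xn mult_in power_in \<open>inverse x \<in> V\<close> by metis
  qed
qed (rule power_in)

text \<open>Divisibility in \<open>V\<close> is a total preorder on nonzero elements, so finitely
  many of them include one that divides all others, a term of least value.\<close>

lemma ex_dominant_term:
  assumes "finite T" "T \<noteq> {}" "\<And>y. y \<in> T \<Longrightarrow> f y \<noteq> 0"
  shows "\<exists>y\<in>T. \<forall>z\<in>T. f z / f y \<in> V"
  using assms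
proof (induction rule: finite_ne_induct)
  case (singleton y)
  then show ?case by (simp add: one_in)
next
  case (insert y T)
  then obtain m where m: "m \<in> T" "\<And>z. z \<in> T \<Longrightarrow> f z / f m \<in> V" by auto
  have nz: "f y \<noteq> 0" "f m \<noteq> 0" using insert.prems m by auto
  show ?case
  proof (cases "f y / f m \<in> V")
    case True
    then show ?thesis using m by auto
  next
    case False
    then have *: "f m / f y \<in> V" using total[of "f y / f m"] by simp
    have "f z / f y \<in> V" if "z \<in> T" for z
      using mult_in[OF m(2)[OF that] *] nz by simp
    then show ?thesis using nz one_in by auto
  qed
qed

text \<open>In a vanishing sum the least value is attained twice. Here \<open>f y\<close> divides
  all terms and \<open>f z\<close> all terms other than \<open>f y\<close>; as \<open>f y\<close> is
  minus the sum of those, \<open>f z\<close> divides \<open>f y\<close> too.\<close>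

lemma sum_zero_imp_unit_quotient:
  assumes "finite T" "T \<noteq> {}" "\<And>y. y \<in> T \<Longrightarrow> f y \<noteq> 0" "sum f T = 0"
  obtains y z where "y \<in> T" "z \<in> T" "y \<noteq> z" "unit (f z / f y)"
proof -
  obtain y where y: "y \<in> T" "\<And>z. z \<in> T \<Longrightarrow> f z / f y \<in> V"
    using ex_dominant_term[of T f] assms(1-3) by blast
  have sum: "f y = - sum f (T - {y})"
    using assms(4) sum.remove[OF assms(1) y(1), of f] by (simp add: eq_neg_iff_add_eq_0)
  then have "T - {y} \<noteq> {}" using assms(3)[OF y(1)] by force
  then obtain z where z: "z \<in> T - {y}" "\<And>t. t \<in> T - {y} \<Longrightarrow> f t / f z \<in> V"
    using ex_dominant_term[of "T - {y}" f] assms by auto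
  have sum_in: "(\<Sum>t\<in>U. g t) \<in> V" if "\<And>t. t \<in> U \<Longrightarrow> g t \<in> V" for U g
    using that by (induction U rule: infinite_finite_induct) (auto simp: zero_in add_in)
  have "f y / f z = - (\<Sum>t\<in>T - {y}. f t / f z)"
    by (subst sum) (simp add: sum_divide_distrib)
  then have "f y / f z \<in> V" using minus_in[OF sum_in[of "T - {y}" "\<lambda>t. f t / f z", OF z(2)]] by simp
  then have "unit (f z / f y)"
    using y z(1) assms(3) by (auto simp: unit_def)
  then show ?thesis using that[of y z] y(1) z(1) by blast
qed

end

section \<open>Powers of elements of a finite extension modulo units\<close>

lemma
  assumes "finite_extension emb"
  shows emb_one: "emb 1 = 1"
    and emb_mult: "emb (a * b) = emb a * emb b"
    and emb_zero: "emb 0 = 0"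
    and emb_minus: "emb (- a) = - emb a"
    and emb_inverse: "emb (inverse a) = inverse (emb a)"
    and emb_eq_0_iff: "emb a = 0 \<longleftrightarrow> a = 0"
    and emb_power: "emb (a ^ n) = emb a ^ n"
proof -
  have add: "emb (a + b) = emb a + emb b" for a b
    using assms by (simp add: finite_extension_def)
  show 1: "emb 1 = 1" and mult: "emb (a * b) = emb a * emb b" for a b
    using assms by (simp_all add: finite_extension_def)
  show 0: "emb 0 = 0" using add[of 0 0] by (metis add_0 add_cancel_left_left)
  show "emb (- a) = - emb a"
    using add[of a "- a"] 0 by (simp add: eq_neg_iff_add_eq_0 add.commute)
  have inv: "emb a * emb (inverse a) = 1" if "a \<noteq> 0" for a
    using mult[of a "inverse a"] 1 that by simp
  then show "emb a = 0 \<longleftrightarrow> a = 0" using 0 by fastforce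
  show "emb (inverse a) = inverse (emb a)"
    using inv[of a] 0 by (cases "a = 0") (auto dest: inverse_unique)
  show "emb (a ^ n) = emb a ^ n"
    by (induction n) (simp_all add: 1 mult)
qed

text \<open>A linear relation over \<open>F\<close> between powers of \<open>x\<close> has two terms
  whose quotient is a unit of \<open>V\<close>. Comparing them makes a power of \<open>x\<close>
  associated to an element of \<open>F\<close>; in terms of values, the value of \<open>x\<close> is
  torsion over those of \<open>F\<close>.\<close>

lemma (in valuation_subring) unit_power_over_base:
  fixes emb :: "'f::field \<Rightarrow> 'a"
  assumes ext: "finite_extension emb" and x: "x \<noteq> 0"
  shows "\<exists>k\<ge>1. \<exists>a. a \<noteq> 0 \<and> unit (x ^ k / emb a)"
proof -
  note emb = emb_one[OF ext] emb_mult[OF ext] emb_inverse[OF ext] emb_eq_0_iff[OF ext]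
  have less: ?thesis if "i < l" "b \<noteq> 0" "unit (emb b * x ^ l / x ^ i)" for i l b
  proof -
    have "emb b * x ^ l / x ^ i = x ^ (l - i) / emb (inverse b)"
      using x that by (simp add: emb power_diff divide_inverse)
    then show ?thesis using that by (intro exI[of _ "l - i"] conjI exI[of _ "inverse b"]) auto
  qed
  \<comment> \<open>If the exponent \<open>l - i\<close> is negative, the inverse of the quotient is
    used.\<close>
  have neq: ?thesis if "i \<noteq> l" "b \<noteq> 0" "unit (emb b * x ^ l / x ^ i)" for i l b
  proof (cases "i < l")
    case True
    then show ?thesis using less that by blast
  next
    case False
    have "inverse (emb b * x ^ l / x ^ i) = emb (inverse b) * x ^ i / x ^ l"
      by (simp add: emb divide_inverse ac_simps)
    then show ?thesis using less[of l i "inverse b"] that False unit_inverse[OF that(3)] by simp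
  qed
  show ?thesis
  \<comment> \<open>Two equal powers have quotient 1, a unit, with coefficient \<open>b = 1\<close>.
    Otherwise the set of powers is infinite, hence linearly dependent.\<close>
  proof (cases "inj (\<lambda>i. x ^ i)")
    case False
    then obtain i l where "i \<noteq> l" "x ^ i = x ^ l" by (auto simp: inj_def)
    then show ?thesis using neq[of i l 1] x by (simp add: emb unit_def one_in)
  next
    case True
    obtain Bs where "finite_dimensional_vector_space (\<lambda>a x. emb a * x) Bs"
      using ext by (auto simp: finite_extension_def)
    then interpret vs: finite_dimensional_vector_space "\<lambda>a x. emb a * x" Bs .
    have "infinite (range (\<lambda>i. x ^ i))" using True by (simp add: finite_image_iff)
    then have "vs.dependent (range (\<lambda>i. x ^ i))" using vs.finiteI_independent by blast
    then obtain t c where t: "finite t" "t \<subseteq> range (\<lambda>i. x ^ i)"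
      "(\<Sum>y\<in>t. emb (c y) * y) = 0" "\<exists>y\<in>t. c y \<noteq> 0"
      unfolding vs.dependent_explicit by blast
    \<comment> \<open>Dropping the terms with coefficient 0 leaves only nonzero summands.\<close>
    define T where "T = {y \<in> t. c y \<noteq> 0}"
    have "(\<Sum>y\<in>T. emb (c y) * y) = 0"
      unfolding T_def t(3)[symmetric] using t(1)
      by (intro sum.mono_neutral_left) (auto simp: emb)
    moreover have "finite T" "T \<noteq> {}" using t by (auto simp: T_def)
    moreover have "emb (c y) * y \<noteq> 0" if "y \<in> T" for y
      using that t(2) x by (auto simp: T_def emb)
    ultimately obtain y z where yz: "y \<in> T" "z \<in> T" "y \<noteq> z" "unit (emb (c z) * z / (emb (c y) * y))"
      using sum_zero_imp_unit_quotient[of T "\<lambda>y. emb (c y) * y"] by blast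
    obtain i l where il: "y = x ^ i" "z = x ^ l" using yz(1,2) t(2) unfolding T_def by blast
    have "emb (c z) * z / (emb (c y) * y) = emb (c z * inverse (c y)) * x ^ l / x ^ i"
      by (simp add: emb il divide_inverse ac_simps)
    then show ?thesis
      using neq[of i l "c z * inverse (c y)"] yz il by (auto simp: T_def)
  qed
qed

section \<open>Valuations\<close>

lemma adj_infty_add_mono:
  fixes a b c d :: "'m::{linorder,ordered_comm_monoid_add} adj_infty"
  shows "a \<le> b \<Longrightarrow> c \<le> d \<Longrightarrow> a + c \<le> b + d"
  by (cases a; cases b; cases c; cases d) (auto intro: add_mono)

context
  fixes v :: "'k::field \<Rightarrow> 'g::linordered_ab_group_add adj_infty"
  assumes v: "valuation v"
begin

lemma valuation_zero: "v 0 = Infty"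
  and valuation_mult: "v (x * y) = v x + v y"
  and valuation_add: "v (x + y) \<ge> min (v x) (v y)"
  using v by (simp_all add: valuation_def)

lemma valuation_Fin:
  assumes "x \<noteq> 0"
  obtains g where "v x = Fin g"
  using v assms by (cases "v x") (auto simp: valuation_def)

lemma valuation_one: "v 1 = Fin 0"
proof -
  obtain g where "v 1 = Fin g" using valuation_Fin[of 1] by auto
  then show ?thesis using valuation_mult[of 1 1] by simp
qed

lemma valuation_power: "v x = Fin g \<Longrightarrow> v (x ^ n) = Fin (nmult n g)"
  by (induction n) (simp_all add: valuation_one valuation_mult)

lemma valuation_inverse:
  assumes "v x = Fin g"
  shows "v (inverse x) = Fin (- g)"
proof -
  have x: "x \<noteq> 0" using assms valuation_zero by auto
  then obtain h where h: "v (inverse x) = Fin h" using valuation_Fin[of "inverse x"] by auto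
  have "v (x * inverse x) = Fin 0" using x valuation_one by simp
  then have "g + h = 0" using assms h by (simp add: valuation_mult)
  then show ?thesis using h by (simp add: eq_neg_iff_add_eq_0 add.commute)
qed

lemma valuation_minus: "v (- x) = v x"
proof -
  obtain g where g: "v (- 1) = Fin g" using valuation_Fin[of "- 1"] by auto
  have "v (- 1 * - 1) = Fin 0" using valuation_one by simp
  then have "g = 0" using g unfolding valuation_mult by simp
  then show ?thesis using valuation_mult[of "- 1" x] g by (cases "v x") auto
qed

lemma in_val_ring_Fin_iff: "v x = Fin g \<Longrightarrow> x \<in> val_ring v \<longleftrightarrow> g \<ge> 0"
  by (simp add: val_ring_def zero_adj_infty_def)

lemma valuation_subring_val_ring: "valuation_subring (val_ring v)"
proof
  show "1 \<in> val_ring v" using in_val_ring_Fin_iff[OF valuation_one] by simp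
next
  fix x y assume "x \<in> val_ring v" "y \<in> val_ring v"
  then have xy: "v x \<ge> 0" "v y \<ge> 0" by (auto simp: val_ring_def)
  show "x - y \<in> val_ring v"
    using xy valuation_add[of x "- y"] by (auto simp: val_ring_def valuation_minus min_def split: if_splits)
  show "x * y \<in> val_ring v"
    using adj_infty_add_mono[OF xy] by (simp add: val_ring_def valuation_mult)
next
  fix x show "x \<in> val_ring v \<or> inverse x \<in> val_ring v"
  proof (cases "x = 0")
    case True
    then show ?thesis by (simp add: val_ring_def valuation_zero)
  next
    case False
    then obtain g where g: "v x = Fin g" by (rule valuation_Fin)
    then show ?thesis
      using in_val_ring_Fin_iff[OF g] in_val_ring_Fin_iff[OF valuation_inverse[OF g]] by auto
  qed
qed

lemma value_groupI: "v x = Fin g \<Longrightarrow> g \<in> value_group v"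
  using valuation_zero unfolding value_group_def by (intro CollectI exI[of _ x]) auto

lemma value_groupE:
  assumes "g \<in> value_group v"
  obtains x where "x \<noteq> 0" "v x = Fin g"
  using assms by (auto simp: value_group_def)

end

text \<open>In the ring of \<open>u\<close> some \<open>x ^ k / emb a\<close> is a unit, so its
  value is 0 and \<open>k * u x\<close> is the image of \<open>v a\<close>. Hence
  \<open>hull_map\<close> is meaningful on the values of \<open>u\<close>.\<close>

lemma torsion_over_value_group:
  fixes u :: "'e::field \<Rightarrow> 'h::linordered_ab_group_add adj_infty"
  assumes ext: "finite_extension emb" and v: "valuation v" and u: "valuation u"
    and uv: "extends emb v \<kappa> u" and h: "u x = Fin h"
  shows "torsion_over (value_group v) \<kappa> h"
proof -
  interpret valuation_subring "val_ring u" using u by (rule valuation_subring_val_ring)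
  have "x \<noteq> 0" using h valuation_zero[OF u] by auto
  then obtain k a where k: "k \<ge> 1" "a \<noteq> 0" "unit (x ^ k / emb a)"
    using unit_power_over_base[OF ext] by blast
  obtain \<gamma> where \<gamma>: "v a = Fin \<gamma>" using valuation_Fin[OF v k(2)] .
  have "u (emb a) = Fin (\<kappa> \<gamma>)" using uv \<gamma> by (simp add: extends_def)
  then have *: "u (x ^ k / emb a) = Fin (nmult k h - \<kappa> \<gamma>)"
    using valuation_mult[OF u] valuation_inverse[OF u] valuation_power[OF u h]
    by (simp add: divide_inverse)
  have "nmult k h = \<kappa> \<gamma>"
    using k(3) in_val_ring_Fin_iff[OF u *] in_val_ring_Fin_iff[OF u valuation_inverse[OF u *]]
    by (simp add: unit_def)
  then show ?thesis
    using k(1) value_groupI[OF v \<gamma>] by (auto simp: torsion_over_def)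
qed

lemma (in subgroup_with_hull) embedding_le_iff:
  assumes "ordered_embedding \<Gamma> \<phi>" "a \<in> \<Gamma>" "b \<in> \<Gamma>"
  shows "\<phi> a \<le> \<phi> b \<longleftrightarrow> a \<le> b"
  using embedding_less[OF assms] embedding_less[OF assms(1,3,2)]
  by (cases a b rule: linorder_cases) auto

lemma (in subgroup_with_hull) embedding_minus:
  fixes \<phi> :: "'g \<Rightarrow> 'h::linordered_ab_group_add"
  assumes "ordered_embedding \<Gamma> \<phi>" "a \<in> \<Gamma>"
  shows "\<phi> (- a) = - \<phi> a"
proof -
  have "\<phi> (- a + a) = \<phi> (- a) + \<phi> a"
    using assms minus_in[OF assms(2)] by (simp only: ordered_embedding_def)
  then show ?thesis using assms(1) by (simp add: ordered_embedding_def eq_neg_iff_add_eq_0)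
qed

lemma nmult_minus:
  fixes a :: "'g::linordered_ab_group_add"
  shows "nmult k (- a) = - nmult k a"
  by (simp add: nmult_def sum_negf)

lemma nmult_nonneg_iff:
  fixes a :: "'g::linordered_ab_group_add"
  assumes "k \<ge> 1"
  shows "nmult k a \<ge> 0 \<longleftrightarrow> a \<ge> 0"
  using nmult_mono[of 0 a k] nmult_strict_mono[of a 0 k] assms by (force simp: nmult_def)

section \<open>The valuation belonging to a valuation ring\<close>

text \<open>The hypothesis \<open>emb_in\<close> says that \<open>V\<close> lies over the ring of
  \<open>v\<close>. The values are taken in the divisible hull, where division by \<open>k\<close>
  is possible and unique.\<close>

lemma valuation_of_valuation_subring:
  fixes v :: "'f::field \<Rightarrow> 'g::linordered_ab_group_add adj_infty"
    and j :: "'g \<Rightarrow> 'd::linordered_ab_group_add"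
    and emb :: "'f \<Rightarrow> 'e::field"
  assumes ext: "finite_extension emb" and v: "valuation v"
    and j: "divisible_hull (value_group v) j"
    and V: "valuation_subring V" and emb_in: "\<And>a. emb a \<in> V \<longleftrightarrow> v a \<ge> 0"
  obtains u where "valuation u" "extends emb v j u" "val_ring u = V"
proof -
  have emb_j: "ordered_embedding (value_group v) j" using j by (simp add: divisible_hull_def)
  \<comment> \<open>The hull itself serves as the monoid, so \<open>j\<close> appears in both
    roles.\<close>
  interpret subgroup_with_hull "value_group v" j j
    using v emb_j j by (rule subgroup_with_hullI)
  interpret V: valuation_subring V by fact
  note j_minus = embedding_minus[OF emb_j]
  note j_nmult = embedding_nmult[OF emb_j]
  note emb = emb_one[OF ext] emb_mult[OF ext] emb_inverse[OF ext] emb_eq_0_iff[OF ext] emb_power[OF ext]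
  \<comment> \<open>\<open>R x d\<close> says that \<open>d\<close> is the value of \<open>x\<close>: for some \<open>k \<ge> 1\<close> and \<open>a\<close>
    the elements \<open>x ^ k\<close> and \<open>a\<close> are associated in \<open>V\<close>, and \<open>d = v a / k\<close>.\<close>
  define R where "R x d \<longleftrightarrow> (\<exists>k a \<gamma>. k \<ge> 1 \<and> a \<noteq> 0 \<and> v a = Fin \<gamma> \<and> V.unit (x ^ k / emb a) \<and> nmult k d = j \<gamma>)"
    for x d
  have R_ex: "\<exists>d. R x d" if x: "x \<noteq> 0" for x
  proof -
    obtain k a where k: "k \<ge> 1" "a \<noteq> 0" "V.unit (x ^ k / emb a)"
      using V.unit_power_over_base[OF ext x] by blast
    obtain \<gamma> where "v a = Fin \<gamma>" using valuation_Fin[OF v k(2)] .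
    moreover obtain d where "nmult k d = j \<gamma>" using j k(1) unfolding divisible_hull_def by blast
    ultimately show ?thesis using k unfolding R_def by blast
  qed
  have R_emb: "R (emb a) (j \<gamma>)" if "v a = Fin \<gamma>" for a \<gamma>
  proof -
    have "a \<noteq> 0" using that valuation_zero[OF v] by auto
    then show ?thesis using that unfolding R_def
      by (intro exI[of _ 1] exI[of _ a] exI[of _ \<gamma>]) (simp add: emb V.unit_def V.one_in)
  qed
  have R_mult: "R (x * y) (d + e)" if "R x d" "R y e" for x y d e
  proof -
    obtain k a \<gamma> where k: "k \<ge> 1" "a \<noteq> 0" "v a = Fin \<gamma>" "V.unit (x ^ k / emb a)" "nmult k d = j \<gamma>"
      using \<open>R x d\<close> unfolding R_def by blast
    obtain l b \<delta> where l: "l \<ge> 1" "b \<noteq> 0" "v b = Fin \<delta>" "V.unit (y ^ l / emb b)" "nmult l e = j \<delta>"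
      using \<open>R y e\<close> unfolding R_def by blast
    have g: "\<gamma> \<in> value_group v" "\<delta> \<in> value_group v"
      using value_groupI[OF v] k(3) l(3) by blast+
    \<comment> \<open>For the common exponent \<open>k * l\<close> of \<open>x\<close> and
      \<open>y\<close>, the associated element of \<open>F\<close> is
      \<open>a ^ l * b ^ k\<close>.\<close>
    have "V.unit ((x ^ k / emb a) ^ l * (y ^ l / emb b) ^ k)"
      using k(4) l(4) by (intro V.unit_mult V.unit_power)
    also have "(x ^ k / emb a) ^ l * (y ^ l / emb b) ^ k = (x * y) ^ (k * l) / emb (a ^ l * b ^ k)"
      by (simp add: emb power_divide power_mult_distrib mult.commute flip: power_mult)
    finally have unit: "V.unit ((x * y) ^ (k * l) / emb (a ^ l * b ^ k))" .
    have val: "v (a ^ l * b ^ k) = Fin (nmult l \<gamma> + nmult k \<delta>)"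
      using valuation_power[OF v k(3)] valuation_power[OF v l(3)] by (simp add: valuation_mult[OF v])
    have "nmult (k * l) (d + e) = nmult l (nmult k d) + nmult k (nmult l e)"
      by (simp only: nmult_add nmult_mult'[of k l d] nmult_mult[of k l e])
    also have "\<dots> = j (nmult l \<gamma>) + j (nmult k \<delta>)"
      using j_nmult g k(5) l(5) by simp
    also have "\<dots> = j (nmult l \<gamma> + nmult k \<delta>)"
      using emb_j j_nmult g by (simp add: ordered_embedding_def)
    finally have "nmult (k * l) (d + e) = j (nmult l \<gamma> + nmult k \<delta>)" .
    moreover have "k * l \<ge> 1" "a ^ l * b ^ k \<noteq> 0" using k l by auto
    ultimately show ?thesis using unit val unfolding R_def by blast
  qed
  have R_inverse: "R (inverse x) (- d)" if "R x d" for x d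
  proof -
    obtain k a \<gamma> where k: "k \<ge> 1" "a \<noteq> 0" "v a = Fin \<gamma>" "V.unit (x ^ k / emb a)" "nmult k d = j \<gamma>"
      using \<open>R x d\<close> unfolding R_def by blast
    have "V.unit (inverse x ^ k / emb (inverse a))"
      using V.unit_inverse[OF k(4)] by (simp add: emb divide_inverse power_inverse)
    moreover have "nmult k (- d) = j (- \<gamma>)"
      using k(5) j_minus[of \<gamma>] value_groupI[OF v k(3)] by (simp add: nmult_minus)
    ultimately show ?thesis
      using k(1,2) valuation_inverse[OF v k(3)] unfolding R_def
      by (intro exI[of _ k] exI[of _ "inverse a"] exI[of _ "- \<gamma>"]) simp
  qed
  \<comment> \<open>Membership in \<open>V\<close> decides the sign of \<open>d\<close>. Uniqueness
    of values, the equality \<open>val_ring u = V\<close> and the inequality for sums all rest on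
    this.\<close>
  have R_sign: "x \<in> V \<longleftrightarrow> d \<ge> 0" if "R x d" for x d
  proof -
    obtain k a \<gamma> where k: "k \<ge> 1" "a \<noteq> 0" "v a = Fin \<gamma>" "V.unit (x ^ k / emb a)" "nmult k d = j \<gamma>"
      using \<open>R x d\<close> unfolding R_def by blast
    have "x \<in> V \<longleftrightarrow> x ^ k \<in> V" using V.power_in_iff k(1) by blast
    also have "x ^ k = emb a * (x ^ k / emb a)" using k(2) by (simp add: emb)
    also have "\<dots> \<in> V \<longleftrightarrow> emb a \<in> V" using V.mult_unit_in_iff[OF k(4)] .
    also have "\<dots> \<longleftrightarrow> \<gamma> \<ge> 0" using k(3) by (simp add: emb_in zero_adj_infty_def)
    also have "\<dots> \<longleftrightarrow> j \<gamma> \<ge> j 0"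
      using embedding_le_iff[OF emb_j zero_in] value_groupI[OF v k(3)] by simp
    also have "\<dots> \<longleftrightarrow> d \<ge> 0"
      using emb_j k(1) nmult_nonneg_iff by (simp add: ordered_embedding_def flip: k(5))
    finally show ?thesis .
  qed
  have R_unique: "d = e" if "x \<noteq> 0" "R x d" "R x e" for x d e
  proof -
    \<comment> \<open>The rules for products and inverses give 1 the value \<open>e - d\<close>,
      which is nonnegative since \<open>1 \<in> V\<close>.\<close>
    have "d \<le> e" if "R x d" "R x e" for d e
      using R_sign[OF R_mult[OF that(2) R_inverse[OF that(1)]]] \<open>x \<noteq> 0\<close> V.one_in by simp
    then show ?thesis using that by (meson order_antisym)
  qed
  define u where "u x = (if x = 0 then Infty else Fin (SOME d. R x d))" for x
  have u_zero: "u 0 = Infty" by (simp add: u_def)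
  have u_eq: "u x = Fin d" if "x \<noteq> 0" "R x d" for x d
    using R_unique[OF that(1) _ that(2)] someI[of "R x", OF that(2)] that(1) by (simp add: u_def)
  have u_mult: "u (x * y) = u x + u y" for x y
  proof (cases "x = 0 \<or> y = 0")
    case False
    then obtain d e where "R x d" "R y e" using R_ex by blast
    then show ?thesis using u_eq R_mult False by simp
  qed (auto simp: u_zero)
  have ring: "val_ring u = V"
  proof (rule set_eqI)
    fix x show "x \<in> val_ring u \<longleftrightarrow> x \<in> V"
    proof (cases "x = 0")
      case True
      then show ?thesis using u_zero V.zero_in by (simp add: val_ring_def)
    next
      case False
      then obtain d where d: "R x d" using R_ex by blast
      then show ?thesis
        using R_sign[OF d] u_eq[OF False d] by (simp add: val_ring_def zero_adj_infty_def)
    qed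
  qed
  \<comment> \<open>Division by \<open>x\<close> reduces the inequality to
    \<open>1 + y / x \<in> V\<close>, which holds because \<open>y / x\<close> has nonnegative
    value.\<close>
  have add: "u x \<le> u (x + y)" if le: "u x \<le> u y" for x y
  proof (cases "x = 0")
    case True
    then have "y = 0" using le by (cases "y = 0") (auto simp: u_def)
    then show ?thesis using True by simp
  next
    case x: False
    then obtain d where d: "R x d" using R_ex by blast
    have "y / x \<in> V"
    proof (cases "y = 0")
      case False
      then obtain e where e: "R y e" using R_ex by blast
      have "d \<le> e" using le u_eq[OF x d] u_eq[OF False e] by simp
      then show ?thesis using R_sign[OF R_mult[OF e R_inverse[OF d]]] by (simp add: divide_inverse)
    qed (simp add: V.zero_in)
    then have "1 + y / x \<in> val_ring u" using V.add_in[OF V.one_in] ring by simp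
    then have "u x + 0 \<le> u x + u (1 + y / x)"
      by (intro adj_infty_add_mono) (auto simp: val_ring_def)
    also have "\<dots> = u (x * (1 + y / x))" by (simp only: u_mult)
    also have "x * (1 + y / x) = x + y" using x by (simp add: distrib_left)
    finally show ?thesis by simp
  qed
  have "valuation u"
    unfolding valuation_def
  proof (intro conjI allI)
    show "min (u x) (u y) \<le> u (x + y)" for x y
      using add[of x y] add[of y x] by (cases "u x \<le> u y") (auto simp: min_def add.commute)
  qed (auto simp: u_mult u_zero, simp add: u_def split: if_splits)
  moreover have "extends emb v j u"
    unfolding extends_def
  proof (intro conjI allI emb_j)
    show "u (emb a) = map_adj_infty j (v a)" for a
    proof (cases "a = 0")
      case True
      then show ?thesis using emb_zero[OF ext] u_zero valuation_zero[OF v] by simp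
    next
      case False
      then obtain \<gamma> where g: "v a = Fin \<gamma>" by (rule valuation_Fin[OF v])
      then show ?thesis using u_eq[OF _ R_emb[OF g]] False by (simp add: emb)
    qed
  qed
  ultimately show ?thesis using that ring by blast
qed

section \<open>Domination\<close>

context
  fixes emb :: "'f::field \<Rightarrow> 'e::field"
    and v :: "'f \<Rightarrow> 'g::linordered_ab_group_add adj_infty"
    and w :: "'e \<Rightarrow> 'm::{linorder,ordered_comm_monoid_add} adj_infty"
    and \<iota> :: "'g \<Rightarrow> 'm"
  assumes ext: "finite_extension emb"
    and v: "valuation v"
    and w: "quasi_valuation w"
    and wv: "extends emb v \<iota> w"
begin

lemma quasi_mult: "w (x * y) \<ge> w x + w y"
  and quasi_add: "w (x + y) \<ge> min (w x) (w y)"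
  and quasi_zero: "w 0 = Infty"
  using w by (simp_all add: quasi_valuation_def)

lemma quasi_emb: "v a = Fin \<gamma> \<Longrightarrow> w (emb a) = Fin (\<iota> \<gamma>)"
  using wv by (simp add: extends_def)

lemma embedding: "ordered_embedding (value_group v) \<iota>"
  using wv by (simp add: extends_def)

lemma quasi_one: "w 1 = 0"
  using quasi_emb[OF valuation_one[OF v]] embedding emb_one[OF ext]
  by (simp add: ordered_embedding_def zero_adj_infty_def)

lemma quasi_power: "w x = Fin m \<Longrightarrow> Fin (nmult n m) \<le> w (x ^ n)"
proof (induction n)
  case (Suc n)
  then have "Fin m + Fin (nmult n m) \<le> w x + w (x ^ n)" by (intro adj_infty_add_mono) auto
  also have "\<dots> \<le> w (x * x ^ n)" by (rule quasi_mult)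
  finally show ?case by simp
qed (simp add: quasi_one zero_adj_infty_def)

text \<open>As \<open>- 1\<close> lies in \<open>F\<close>, its value is 0 by comparison with
  \<open>v\<close>. Multiplication by \<open>- 1\<close> then gives one inequality, and the same for
  \<open>- x\<close> gives the other.\<close>

lemma quasi_minus: "w (- x) = w x"
proof -
  have "w (emb (- 1)) = Fin 0"
    using quasi_emb[of "- 1"] valuation_minus[OF v, of 1] valuation_one[OF v] embedding
    by (simp add: ordered_embedding_def)
  then have "w (- 1) = 0"
    using emb_minus[OF ext, of 1] emb_one[OF ext] by (simp add: zero_adj_infty_def)
  then have "w x \<le> w (- x)" for x using quasi_mult[of "- 1" x] by simp
  from this[of x] this[of "- x"] show ?thesis by simp
qed

lemma dominates_if_val_ring_subset:
  fixes u :: "'e \<Rightarrow> 'h::linordered_ab_group_add adj_infty"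
    and j :: "'g \<Rightarrow> 'd::linordered_ab_group_add"
  assumes tors: "torsion_values (value_group v) \<iota> w" and j: "divisible_hull (value_group v) j"
    and u: "valuation u" and uv: "extends emb v \<kappa> u" and sub: "val_ring w \<subseteq> val_ring u"
  shows "dominates v j \<kappa> u \<iota> w"
  unfolding dominates_def
proof
  have \<kappa>: "ordered_embedding (value_group v) \<kappa>" using uv by (simp add: extends_def)
  interpret \<iota>: subgroup_with_hull "value_group v" \<iota> j
    using v embedding j by (rule subgroup_with_hullI)
  interpret \<kappa>: subgroup_with_hull "value_group v" \<kappa> j
    using v \<kappa> j by (rule subgroup_with_hullI)
  fix x
  show "map_adj_infty (hull_map (value_group v) \<iota> j) (w x)
         \<le> map_adj_infty (hull_map (value_group v) \<kappa> j) (u x)"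
  proof (cases "x = 0")
    case True
    then show ?thesis using quasi_zero valuation_zero[OF u] by simp
  next
    case False
    obtain m where m: "w x = Fin m" "torsion_over (value_group v) \<iota> m"
      using tors False unfolding torsion_values_def by blast
    obtain h where h: "u x = Fin h" using False by (rule valuation_Fin[OF u])
    have h_tors: "torsion_over (value_group v) \<kappa> h"
      using torsion_over_value_group[OF ext v u uv h] .
    obtain k \<gamma> where k: "k \<ge> 1" "\<gamma> \<in> value_group v" "nmult k m = \<iota> \<gamma>"
      "nmult k (hull_map (value_group v) \<iota> j m) = j \<gamma>"
      using m(2) by (rule \<iota>.hull_mapE)
    obtain l \<delta> where l: "l \<ge> 1" "\<delta> \<in> value_group v" "nmult l h = \<kappa> \<delta>"
      "nmult l (hull_map (value_group v) \<kappa> j h) = j \<delta>"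
      using h_tors by (rule \<kappa>.hull_mapE)
    obtain a where a: "a \<noteq> 0" "v a = Fin \<gamma>" using k(2) by (rule value_groupE[OF v])
    have inv: "v (inverse a) = Fin (- \<gamma>)" using valuation_inverse[OF v a(2)] .
    \<comment> \<open>The lower bound for the value of a product suffices to place
      \<open>x ^ k / emb a\<close> in the ring of \<open>w\<close>, hence in that of
      \<open>u\<close>.\<close>
    have "0 = Fin (\<iota> (- \<gamma>)) + Fin (nmult k m)"
    proof -
      have "\<iota> (- \<gamma>) + \<iota> \<gamma> = \<iota> (- \<gamma> + \<gamma>)"
        using k(2) \<iota>.minus_in[OF k(2)] embedding by (simp only: ordered_embedding_def)
      then show ?thesis using embedding k(3) by (simp add: ordered_embedding_def zero_adj_infty_def)
    qed
    also have "\<dots> \<le> w (emb (inverse a)) + w (x ^ k)"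
      using quasi_emb[OF inv] quasi_power[OF m(1)] by (intro adj_infty_add_mono) auto
    also have "\<dots> \<le> w (emb (inverse a) * x ^ k)" by (rule quasi_mult)
    finally have "emb (inverse a) * x ^ k \<in> val_ring u" using sub by (auto simp: val_ring_def)
    moreover have "u (emb a) = Fin (\<kappa> \<gamma>)" using uv a by (simp add: extends_def)
    then have "u (emb (inverse a)) = Fin (- \<kappa> \<gamma>)"
      using valuation_inverse[OF u] emb_inverse[OF ext] by simp
    then have "u (emb (inverse a) * x ^ k) = Fin (- \<kappa> \<gamma> + nmult k h)"
      using valuation_mult[OF u] valuation_power[OF u h] by simp
    ultimately have "\<kappa> \<gamma> \<le> nmult k h"
      using in_val_ring_Fin_iff[OF u] by simp
    \<comment> \<open>Multiplying by \<open>l\<close> turns both sides into images of elements of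
      the value group of \<open>v\<close>, where the order can be carried from \<kappa> to
      \<open>j\<close>. Cancelling \<open>l * k\<close> in the hull then gives the claim.\<close>
    then have "nmult l (\<kappa> \<gamma>) \<le> nmult l (nmult k h)" by (rule nmult_mono)
    also have "\<dots> = nmult k (\<kappa> \<delta>)" by (simp only: l(3)[symmetric] nmult_mult[symmetric] mult.commute)
    finally have "\<kappa> (nmult l \<gamma>) \<le> \<kappa> (nmult k \<delta>)"
      using \<kappa>.embedding_nmult[OF \<kappa>] k(2) l(2) by simp
    then have "j (nmult l \<gamma>) \<le> j (nmult k \<delta>)"
      using \<kappa>.embedding_le_iff[OF \<kappa>, of "nmult l \<gamma>" "nmult k \<delta>"]
        \<kappa>.embedding_le_iff[OF \<kappa>.embedding_j, of "nmult l \<gamma>" "nmult k \<delta>"]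
        \<kappa>.embedding_nmult[OF \<kappa>] k(2) l(2) by blast
    then have "nmult l (nmult k (hull_map (value_group v) \<iota> j m))
        \<le> nmult k (nmult l (hull_map (value_group v) \<kappa> j h))"
      using \<kappa>.embedding_nmult[OF \<kappa>.embedding_j] k l by simp
    then have "nmult (l * k) (hull_map (value_group v) \<iota> j m)
        \<le> nmult (l * k) (hull_map (value_group v) \<kappa> j h)"
      by (simp only: nmult_mult[of l k "hull_map _ \<iota> j m"] nmult_mult'[of l k "hull_map _ \<kappa> j h"])
    moreover have "l * k \<ge> 1" using k(1) l(1) by simp
    ultimately have "hull_map (value_group v) \<iota> j m \<le> hull_map (value_group v) \<kappa> j h"
      using nmult_strict_mono[of "hull_map (value_group v) \<kappa> j h"
          "hull_map (value_group v) \<iota> j m" "l * k"] by force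
    then show ?thesis using m h by simp
  qed
qed

section \<open>A valuation whose ring contains the ring of the quasi-valuation\<close>

lemma quasi_emb_pos:
  assumes "v c > 0"
  shows "w (emb c) > 0"
proof (cases "v c")
  case (Fin \<gamma>)
  have "0 < \<gamma>" using assms Fin by (auto simp: zero_adj_infty_def less_adj_infty_def)
  moreover have "0 \<in> value_group v" "\<gamma> \<in> value_group v"
    using value_groupI[OF v] valuation_one[OF v] Fin by blast+
  ultimately have "\<iota> 0 < \<iota> \<gamma>"
    using embedding unfolding ordered_embedding_def strict_mono_on_def by blast
  then show ?thesis
    using quasi_emb[OF Fin] embedding
    by (auto simp: zero_adj_infty_def less_adj_infty_def ordered_embedding_def)
next
  case Infty
  then have "w (emb c) = Infty" using wv by (simp add: extends_def)
  then show ?thesis by (simp add: zero_adj_infty_def less_adj_infty_def)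
qed

lemma quasi_emb_nonneg:
  assumes "v c \<ge> 0"
  shows "w (emb c) \<ge> 0"
proof (cases "v c = 0")
  case True
  then show ?thesis
    using quasi_emb[of c 0] embedding by (simp add: zero_adj_infty_def ordered_embedding_def)
next
  case False
  then have "v c > 0" using assms by simp
  then show ?thesis using quasi_emb_pos[of c] by simp
qed

text \<open>The ideal contains \<open>emb c\<close> whenever \<open>v c > 0\<close>, so these
  elements remain nonunits in Chevalley's ring. It is proper because
  \<open>w (emb c) > 0 = w 1\<close>.\<close>

lemma proper_ideal_val_ring:
  "proper_ideal (val_ring w) {x. \<exists>c. v c > 0 \<and> w (emb c) \<le> w x}"
proof
  show "1 \<in> val_ring w" by (simp add: val_ring_def quasi_one)
next
  fix x y assume "x \<in> val_ring w" "y \<in> val_ring w"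
  then have xy: "w x \<ge> 0" "w y \<ge> 0" by (auto simp: val_ring_def)
  show "x - y \<in> val_ring w"
    using xy quasi_add[of x "- y"] by (auto simp: val_ring_def quasi_minus min_def split: if_splits)
  show "x * y \<in> val_ring w"
    using adj_infty_add_mono[OF xy] quasi_mult[of x y] by (simp add: val_ring_def)
next
  show "{x. \<exists>c. v c > 0 \<and> w (emb c) \<le> w x} \<subseteq> val_ring w"
    using quasi_emb_pos by (force simp: val_ring_def)
  have "v 0 > 0" by (simp add: valuation_zero[OF v] zero_adj_infty_def less_adj_infty_def)
  then show "0 \<in> {x. \<exists>c. v c > 0 \<and> w (emb c) \<le> w x}" by (auto simp: quasi_zero)
  show "1 \<notin> {x. \<exists>c. v c > 0 \<and> w (emb c) \<le> w x}"
    using quasi_emb_pos by (auto simp: quasi_one not_le)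
next
  fix x y assume "x \<in> {x. \<exists>c. v c > 0 \<and> w (emb c) \<le> w x}" "y \<in> {x. \<exists>c. v c > 0 \<and> w (emb c) \<le> w x}"
  then obtain c d where "v c > 0" "w (emb c) \<le> w x" "v d > 0" "w (emb d) \<le> w y" by blast
  \<comment> \<open>The bound for the summand of smaller value also serves for the sum.\<close>
  then show "x + y \<in> {x. \<exists>c. v c > 0 \<and> w (emb c) \<le> w x}"
    using quasi_add[of x y] by (cases "w x \<le> w y") (auto simp: min_def intro: order_trans)
next
  fix x y assume "x \<in> val_ring w" "y \<in> {x. \<exists>c. v c > 0 \<and> w (emb c) \<le> w x}"
  then obtain c where c: "0 \<le> w x" "v c > 0" "w (emb c) \<le> w y" by (auto simp: val_ring_def)
  have "w (emb c) \<le> w (x * y)"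
    using adj_infty_add_mono[OF c(1,3)] quasi_mult[of x y] by simp
  then show "x * y \<in> {x. \<exists>c. v c > 0 \<and> w (emb c) \<le> w x}" using c(2) by blast
qed

lemma ex_valuation_with_larger_ring:
  fixes j :: "'g \<Rightarrow> 'd::linordered_ab_group_add"
  assumes j: "divisible_hull (value_group v) j"
  obtains u where "valuation u" "extends emb v j u" "val_ring w \<subseteq> val_ring u"
proof -
  obtain V where V: "valuation_subring V" "val_ring w \<subseteq> V"
    and "\<And>x. x \<in> {x. \<exists>c. v c > 0 \<and> w (emb c) \<le> w x} \<Longrightarrow> inverse x \<in> V \<Longrightarrow> x = 0"
    by (rule chevalley[OF proper_ideal_val_ring], rule that)
  then have nonunit: "\<exists>c. v c > 0 \<and> w (emb c) \<le> w x \<Longrightarrow> inverse x \<in> V \<Longrightarrow> x = 0" for x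
    by simp
  have "emb a \<in> V \<longleftrightarrow> v a \<ge> 0" for a
  proof
    assume a: "emb a \<in> V"
    show "v a \<ge> 0"
    proof (rule ccontr)
      assume "\<not> v a \<ge> 0"
      moreover from this obtain \<gamma> where \<gamma>: "v a = Fin \<gamma>" by (cases "v a") auto
      ultimately have "v (inverse a) > 0"
        using valuation_inverse[OF v \<gamma>] by (simp add: zero_adj_infty_def less_adj_infty_def)
      \<comment> \<open>With \<open>c = inverse a\<close>, the element
        \<open>emb (inverse a)\<close> lies in the ideal, while its inverse \<open>emb a\<close>
        lies in \<open>V\<close>; only 0 allows this.\<close>
      then have "emb (inverse a) = 0"
        using a order_refl by (intro nonunit exI[of _ "inverse a"]) (simp_all add: emb_inverse[OF ext])
      then have "a = 0" by (simp add: emb_eq_0_iff[OF ext])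
      then show False using \<gamma> valuation_zero[OF v] by simp
    qed
  next
    assume "v a \<ge> 0"
    then show "emb a \<in> V" using quasi_emb_nonneg V(2) by (auto simp: val_ring_def)
  qed
  then obtain u where "valuation u" "extends emb v j u" "val_ring u = V"
    using valuation_of_valuation_subring[OF ext v j V(1)] by blast
  then show ?thesis using that V(2) by blast
qed

end

theorem theorem6p3:
  fixes emb :: "'f::field \<Rightarrow> 'e::field"
    and v :: "'f \<Rightarrow> 'g::linordered_ab_group_add adj_infty"
    and w :: "'e \<Rightarrow> 'm::{linorder,ordered_comm_monoid_add} adj_infty"
    and \<iota> :: "'g \<Rightarrow> 'm"
    and j :: "'g \<Rightarrow> 'd::linordered_ab_group_add"
  assumes "finite_extension emb"
    and "valuation v"
    and "quasi_valuation w"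
    and "extends emb v \<iota> w"
    and "torsion_values (value_group v) \<iota> w"
    and "divisible_hull (value_group v) j"
  shows "(\<exists>u :: 'e \<Rightarrow> 'd adj_infty.
            valuation u \<and> extends emb v j u \<and> dominates v j j u \<iota> w) \<and>
         (\<forall>(u :: 'e \<Rightarrow> 'h::linordered_ab_group_add adj_infty) \<kappa>.
            valuation u \<longrightarrow> extends emb v \<kappa> u \<longrightarrow> val_ring w \<subseteq> val_ring u \<longrightarrow>
            dominates v j \<kappa> u \<iota> w)"
proof (intro conjI allI impI)
  \<comment> \<open>Existence follows from the criterion on rings, applied to a valuation with
    values in the divisible hull.\<close>
  obtain u :: "'e \<Rightarrow> 'd adj_infty"
    where u: "valuation u" "extends emb v j u" "val_ring w \<subseteq> val_ring u"
    using ex_valuation_with_larger_ring[OF assms(1-4,6)] by blast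
  then show "\<exists>u :: 'e \<Rightarrow> 'd adj_infty. valuation u \<and> extends emb v j u \<and> dominates v j j u \<iota> w"
    using dominates_if_val_ring_subset[OF assms(1-6)] by blast
next
  fix u :: "'e \<Rightarrow> 'h adj_infty" and \<kappa>
  assume "valuation u" "extends emb v \<kappa> u" "val_ring w \<subseteq> val_ring u"
  then show "dominates v j \<kappa> u \<iota> w"
    by (rule dominates_if_val_ring_subset[OF assms])
qed

end
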